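(* Let $\mathcal{C}\subset\mathbb{R}^{n\times n}_+$ be a set of entrywise nonnegative matrices, and let $\hat{\mathbf{M}}_{\mathrm{perm}},\hat{\mathbf{M}}_{\mathrm{cap}}\in\mathcal{C}$ be maximizers $$\hat{\mathbf{M}}_{\mathrm{perm}}=\arg\sup_{\mathbf{M}\in\mathcal{C}}\ \mathrm{perm}(\mathbf{M}),\qquad \hat{\mathbf{M}}_{\mathrm{cap}}=\arg\sup_{\mathbf{M}\in\mathcal{C}}\ \mathrm{cap}(p_{\mathbf{M}}).$$ Then $$\frac{n!}{n^n}\,\mathrm{perm}(\hat{\mathbf{M}}_{\mathrm{perm}})\le \mathrm{perm}(\hat{\mathbf{M}}_{\mathrm{cap}})\le \mathrm{perm}(\hat{\mathbf{M}}_{\mathrm{perm}}).$$ Moreover, if every matrix in $\mathcal{C}$ has at most $k$ nonzeros in each column, then the factor $\frac{n!}{n^n}$ in the lower bound can be replaced by $\left(\frac{k-1}{k}\right)^{(k-1)n}$.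
   Context: $\mathbb{R}^{n\times n}_+$ is the set of entrywise nonnegative real $n\times n$ matrices. The permanent is $\mathrm{perm}(\mathbf{M})=\sum_{\sigma\in\mathfrak{S}_n}\prod_{i=1}^n M_{i,\sigma(i)}$, where $\mathfrak{S}_n$ is the set of permutations of $\{1,\dots,n\}$. For $\mathbf{M}\in\mathbb{R}^{n\times n}_+$, $p_{\mathbf{M}}(y_1,\dots,y_n)=\prod_{i=1}^n\big(\sum_{j=1}^n M_{i,j}y_j\big)$. The capacity of a homogeneous polynomial $p$ of degree $n$ in $\mathbf{y}\in\mathbb{R}^n_+$ is $\mathrm{cap}(p)=\inf\{p(\mathbf{y}) \mid \mathbf{y}\in\mathbb{R}^n_+,\ y_1\cdots y_n=1\}$. Here $k\ge1$ is an integer and $0^0=1$. *)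

theory Defs
  imports "HOL-Analysis.Analysis"
begin

definition permanent :: "real^'n^'n \<Rightarrow> real" where
  "permanent M = (\<Sum>\<sigma> | \<sigma> permutes UNIV. \<Prod>i\<in>UNIV. M $ i $ \<sigma> i)"

text \<open>
  Polynomials in \<open>n\<close> real variables are represented by their polynomial functions on \<open>\<real>\<^sup>n\<close>,
  where \<open>n = CARD('n)\<close>.
\<close>

definition row_product_poly :: "real^'n^'n \<Rightarrow> real^'n \<Rightarrow> real" where
  "row_product_poly M y = (\<Prod>i\<in>UNIV. \<Sum>j\<in>UNIV. M $ i $ j * y $ j)"

text \<open>
  The set below is nonempty whatever \<open>p\<close> is (take all \<open>y\<^sub>i = 1\<close>). The real-valued \<open>Inf\<close> is the
  actual infimum when the set is bounded below, as it is by \<open>0\<close> if \<open>p\<close> has nonnegative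
  coefficients.
\<close>

definition capacity :: "(real^'n \<Rightarrow> real) \<Rightarrow> real" where
  "capacity p = Inf {p y | y. (\<forall>i. 0 \<le> y $ i) \<and> (\<Prod>i\<in>UNIV. y $ i) = 1}"

end

theory Submission
  imports Defs "HOL-Computational_Algebra.Fundamental_Theorem_Algebra"
begin

text \<open>
  Everything follows from \<open>perm(M) \<le> cap(p\<^sub>M)\<close> and Gurvits's converse bound
  \<open>F cap(p\<^sub>M) \<le> perm(M)\<close>. The permanent arises from \<open>p\<^sub>M\<close> by differentiating in one variable after
  the other and setting that variable to \<open>0\<close>. If a homogeneous \<open>p\<close> has no zeros in the open right half-plane and
  nonnegative coefficients, then \<open>R(t) = p(x, t)\<close> has only real nonpositive roots for \<open>x > 0\<close>, so by the
  arithmetic-geometric mean inequality \<open>R(t) \<ge> K t\<close> for all \<open>t > 0\<close> implies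
  \<open>R'(0) \<ge> ((d - 1) / d)\<^bsup>d - 1\<^esup> K\<close> when \<open>R\<close> has degree at most \<open>d\<close>. Stability is inherited by the derivative
  (Gauss-Lucas). With \<open>m\<close> variables left, \<open>d\<close> can be either \<open>m\<close>, giving the product \<open>n! / n\<^sup>n\<close>, or the
  maximal number \<open>k\<close> of nonzeros in a column.

  Stability is handled in the row variables \<open>y\<^sub>i = \<Sum>\<^sub>j M\<^sub>i\<^sub>j x\<^sub>j\<close>, in which the successive derivatives are
  multiaffine: \<open>p\<^sub>M\<close> is \<open>\<Prod>\<^sub>i y\<^sub>i\<close>, and \<open>\<partial>/\<partial>x\<^sub>j\<close> becomes the derivative along the \<open>j\<close>-th column of \<open>M\<close>.
\<close>

section \<open>Complex polynomials with roots in a half-plane\<close>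

text \<open>After division by \<open>w ^ Suc n\<close> this is Bernoulli's inequality:
  \<open>?x\<close> satisfies \<open>1 + Suc n * ?x = u / w\<close>, and the mean equals
  \<open>w * (1 + ?x)\<close>.\<close>

lemma weighted_am_gm:
  fixes u w :: real
  assumes "u \<ge> 0" "w > 0"
  shows "u * w ^ n \<le> ((u + real n * w) / real (Suc n)) ^ Suc n"
proof -
  let ?x = "(u / w - 1) / real (Suc n)"
  have *: "(u + real n * w) / real (Suc n) = w * (1 + ?x)"
  proof -
    have "w * (1 + ?x) = w + (u - w) / real (Suc n)"
      using assms by (simp add: right_diff_distrib distrib_left)
    thus ?thesis by (simp add: field_simps)
  qed
  have "- real (Suc n) \<le> u / w - 1"
  proof -
    have "0 \<le> u / w" using assms by simp
    thus ?thesis by linarith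
  qed
  hence "?x \<ge> -1"
    by (simp add: field_simps)
  from Bernoulli_inequality[OF this, of "Suc n"] have "u / w \<le> (1 + ?x) ^ Suc n"
    by simp
  hence "w ^ Suc n * (u / w) \<le> w ^ Suc n * (1 + ?x) ^ Suc n"
    using assms by (intro mult_left_mono) auto
  also have "\<dots> = ((u + real n * w) / real (Suc n)) ^ Suc n"
    by (simp only: * power_mult_distrib)
  finally show ?thesis
    using assms by (simp add: field_simps)
qed

lemma complex_poly_root_factor:
  fixes P :: "complex poly"
  assumes "degree P > 0"
  obtains r Q where "P = [:- r, 1:] * Q" "poly P r = 0" "degree P = Suc (degree Q)"
proof -
  have "\<not> constant (poly P)"
    using assms by (simp add: constant_degree)
  then obtain r where r: "poly P r = 0"
    using fundamental_theorem_of_algebra by blast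
  then obtain Q where Q: "P = [:- r, 1:] * Q"
    by (auto simp: poly_eq_0_iff_dvd)
  moreover have "Q \<noteq> 0"
    using Q assms by auto
  ultimately have "degree P = Suc (degree Q)"
    by (simp add: degree_mult_eq del: mult_pCons_left)
  with Q r that show thesis by blast
qed

text \<open>Factor by factor: a root in the closed left half-plane is at least as close to 0 as to
  1.\<close>

lemma norm_poly_0_le_norm_poly_1:
  fixes P :: "complex poly"
  assumes "\<And>r. poly P r = 0 \<Longrightarrow> Re r \<le> 0"
  shows "norm (poly P 0) \<le> norm (poly P 1)"
  using assms
proof (induction "degree P" arbitrary: P)
  case 0
  then obtain a where "P = [:a:]" by (metis degree_eq_zeroE)
  then show ?case by simp
next
  case (Suc d)
  obtain r Q where rQ: "P = [:- r, 1:] * Q" "poly P r = 0" "degree P = Suc (degree Q)"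
    using complex_poly_root_factor Suc.hyps(2) by (metis zero_less_Suc)
  have "norm (poly Q 0) \<le> norm (poly Q 1)"
    using Suc rQ by (intro Suc.hyps(1)) auto
  moreover have "norm r \<le> norm (1 - r)"
  proof -
    have "Re r \<le> 0" using Suc.prems rQ by blast
    hence "(Re r)\<^sup>2 \<le> (1 - Re r)\<^sup>2"
      by (simp add: power2_eq_square algebra_simps)
    hence "(norm r)\<^sup>2 \<le> (norm (1 - r))\<^sup>2"
      by (simp add: cmod_power2)
    thus ?thesis by (rule power2_le_imp_le) simp
  qed
  ultimately show ?case
    by (simp add: rQ(1) norm_mult mult_mono del: mult_pCons_left)
qed

text \<open>The logarithmic derivative at \<open>0\<close> is the sum of the \<open>-1/r\<close> over the roots \<open>r\<close>, and each
  summand has positive real part.\<close>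

lemma Re_log_deriv_pos:
  fixes P :: "complex poly"
  assumes "\<And>r. poly P r = 0 \<Longrightarrow> Re r < 0" "degree P > 0"
  shows "Re (poly (pderiv P) 0 / poly P 0) > 0"
  using assms
proof (induction "degree P" arbitrary: P)
  case 0
  then show ?case by simp
next
  case (Suc d)
  obtain r Q where rQ: "P = [:- r, 1:] * Q" "poly P r = 0" "degree P = Suc (degree Q)"
    using complex_poly_root_factor Suc.prems(2) by metis
  have r: "Re r < 0" "r \<noteq> 0" using Suc.prems rQ by force+
  have Q0: "poly Q 0 \<noteq> 0" using Suc.prems(1)[of 0] rQ by auto
  \<comment> \<open>The cofactor may be constant and then contributes 0; strictness comes from the
    root \<open>r\<close>.\<close>
  have "Re (poly (pderiv Q) 0 / poly Q 0) \<ge> 0"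
  proof (cases "degree Q = 0")
    case True
    then show ?thesis by (metis degree_eq_zeroE pderiv_singleton poly_0 div_0 zero_complex.sel(1) order_refl)
  next
    case False
    then show ?thesis using Suc rQ by (intro less_imp_le Suc.hyps(1)) auto
  qed
  moreover have "poly (pderiv P) 0 / poly P 0 = poly (pderiv Q) 0 / poly Q 0 + (- 1 / r)"
    using r Q0 unfolding rQ(1) pderiv_mult by (simp add: pderiv_pCons field_simps)
  moreover have "Re (- 1 / r) > 0"
    using r by (simp add: Re_divide divide_neg_pos power2_eq_square add_pos_nonneg mult_neg_neg)
  ultimately show ?case by simp
qed

text \<open>Here \<open>P(t)\<close> is \<open>P(0)\<close> times the product of the
  \<open>1 + t / b\<close> over the roots \<open>-b\<close>, and \<open>a\<close> is the sum of the
  \<open>1 / b\<close>. The bound is the arithmetic-geometric mean inequality for these factors,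
  padded with ones up to \<open>d\<close> factors.\<close>

lemma negative_roots_bound:
  fixes P :: "complex poly"
  assumes "\<And>r. poly P r = 0 \<Longrightarrow> \<exists>b>0. r = - complex_of_real b" "degree P \<le> d"
  shows "\<exists>a\<ge>0. poly (pderiv P) 0 = of_real a * poly P 0 \<and>
    (\<forall>t\<ge>0. norm (poly P (of_real t)) \<le> norm (poly P 0) * (1 + a * t / real d) ^ d)"
  using assms
proof (induction d arbitrary: P)
  case 0
  then obtain c where "P = [:c:]" by (metis degree_eq_zeroE le_zero_eq)
  then show ?case by (intro exI[of _ 0]) (auto simp: pderiv_pCons)
next
  case (Suc d)
  show ?case
  proof (cases "degree P = 0")
    case True
    then obtain c where "P = [:c:]" by (metis degree_eq_zeroE)
    then show ?thesis by (intro exI[of _ 0]) (auto simp: pderiv_pCons)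
  next
    case False
    then obtain r Q where rQ: "P = [:- r, 1:] * Q" "poly P r = 0" "degree P = Suc (degree Q)"
      using complex_poly_root_factor by (metis neq0_conv)
    obtain b where b: "b > 0" "r = - complex_of_real b"
      using Suc.prems(1) rQ by blast
    obtain a where a: "a \<ge> 0" "poly (pderiv Q) 0 = of_real a * poly Q 0"
      "\<And>t. t \<ge> 0 \<Longrightarrow> norm (poly Q (of_real t)) \<le> norm (poly Q 0) * (1 + a * t / real d) ^ d"
      using Suc.IH[of Q] Suc.prems rQ by auto
    show ?thesis
    proof (intro exI[of _ "a + 1 / b"] conjI allI impI)
      show "0 \<le> a + 1 / b" using a b by simp
      show "poly (pderiv P) 0 = of_real (a + 1 / b) * poly P 0"
        using b a(2) unfolding rQ(1) pderiv_mult by (simp add: pderiv_pCons field_simps)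
      fix t :: real assume t: "t \<ge> 0"
      have "norm (poly P (of_real t)) = (b + t) * norm (poly Q (of_real t))"
      proof -
        have "poly P (of_real t) = of_real (b + t) * poly Q (of_real t)"
          by (simp add: rQ(1) b algebra_simps)
        thus ?thesis using b t by (simp add: norm_mult del: of_real_add)
      qed
      also have "\<dots> \<le> (b + t) * (norm (poly Q 0) * (1 + a * t / real d) ^ d)"
        using a b t by (intro mult_left_mono) auto
      also have "\<dots> = norm (poly P 0) * ((1 + t / b) * (1 + a * t / real d) ^ d)"
        using b by (simp add: rQ(1) norm_mult field_simps)
      also have "\<dots> \<le> norm (poly P 0) * (1 + (a + 1 / b) * t / real (Suc d)) ^ Suc d"
      proof (rule mult_left_mono)
        \<comment> \<open>Equality for \<open>d > 0\<close>; for \<open>d = 0\<close> the quotient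
          is 0 and only the inequality is left.\<close>
        have "real d * (1 + a * t / real d) \<le> real d + a * t"
          using a t by (cases "d = 0") (auto simp: distrib_left)
        hence "(1 + t / b + real d * (1 + a * t / real d)) / real (Suc d) \<le>
            (real (Suc d) + (a + 1 / b) * t) / real (Suc d)"
          by (intro divide_right_mono) (auto simp: algebra_simps)
        hence *: "(1 + t / b + real d * (1 + a * t / real d)) / real (Suc d) \<le>
            1 + (a + 1 / b) * t / real (Suc d)"
          by (simp add: add_divide_distrib del: of_nat_Suc)
        have "(1 + t / b) * (1 + a * t / real d) ^ d \<le>
            ((1 + t / b + real d * (1 + a * t / real d)) / real (Suc d)) ^ Suc d"
          using a b t by (intro weighted_am_gm) (auto intro: add_pos_nonneg)
        also have "\<dots> \<le> (1 + (a + 1 / b) * t / real (Suc d)) ^ Suc d"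
          using a b t by (intro power_mono *) auto
        finally show "(1 + t / b) * (1 + a * t / real d) ^ d \<le>
            (1 + (a + 1 / b) * t / real (Suc d)) ^ Suc d" .
      qed simp
      finally show "norm (poly P (of_real t)) \<le>
          norm (poly P 0) * (1 + (a + 1 / b) * t / real (Suc d)) ^ Suc d" .
    qed
  qed
qed

text \<open>For \<open>d \<ge> 1\<close> this is the reciprocal of the infimum of
  \<open>(1 + t / d) ^ d / t\<close> over \<open>t > 0\<close>. At \<open>d = 1\<close> it is
  \<open>0 ^ 0 = 1\<close>.\<close>

definition gurvits_factor :: "nat \<Rightarrow> real" where
  "gurvits_factor d = ((real d - 1) / real d) ^ (d - 1)"

text \<open>The extremal case is \<open>P(t) = (1 + a t / d)\<^sup>d\<close>, for which \<open>P(t) / t\<close> is minimal at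
  \<open>t = d / (a (d - 1))\<close>.\<close>

lemma negative_roots_deriv_ge:
  fixes P :: "complex poly"
  assumes roots: "\<And>r. poly P r = 0 \<Longrightarrow> \<exists>b>0. r = - complex_of_real b"
    and deg: "degree P \<le> d" and d: "d \<ge> 1" and K: "K \<ge> 0"
    and ge: "\<And>t. t > 0 \<Longrightarrow> K * t \<le> norm (poly P (of_real t))"
  shows "gurvits_factor d * K \<le> norm (poly (pderiv P) 0)"
proof -
  obtain a where a: "a \<ge> 0" "poly (pderiv P) 0 = of_real a * poly P 0"
    "\<And>t. t \<ge> 0 \<Longrightarrow> norm (poly P (of_real t)) \<le> norm (poly P 0) * (1 + a * t / real d) ^ d"
    using negative_roots_bound[OF roots deg] by auto
  define p where "p = norm (poly P 0)"
  have p: "p \<ge> 0" by (simp add: p_def)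
  have ge': "K * t \<le> p * (1 + a * t / real d) ^ d" if "t > 0" for t
    using ge[OF that] a(3)[of t] that unfolding p_def by linarith
  have deriv: "norm (poly (pderiv P) 0) = a * p"
    using a by (simp add: norm_mult p_def)
  have linear: "K \<le> C" if "\<And>t. t > 0 \<Longrightarrow> K * t \<le> p + C * t" for C
  proof (rule ccontr)
    assume "\<not> K \<le> C"
    hence "K * ((p + 1) / (K - C)) \<le> p + C * ((p + 1) / (K - C))"
      using p by (intro that) auto
    hence "(K - C) * ((p + 1) / (K - C)) \<le> p"
      by (simp only: left_diff_distrib)
    with \<open>\<not> K \<le> C\<close> show False by simp
  qed
  \<comment> \<open>A minimizer of the upper bound divided by \<open>t\<close> is available only in
    the third case. In the first two the bound is affine in \<open>t\<close>, and slopes are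
    compared for large \<open>t\<close>.\<close>
  consider "d = 1" | "a = 0" "d > 1" | "a > 0" "d > 1" using a d by linarith
  then show ?thesis
  proof cases
    case 1
    have "K \<le> a * p" using ge' 1 by (intro linear) (simp add: algebra_simps)
    then show ?thesis using 1 by (simp add: deriv gurvits_factor_def)
  next
    case 2
    have "K \<le> 0" using ge' 2 by (intro linear) simp
    then show ?thesis using 2 K by simp
  next
    case 3
    define t where "t = real d / (a * (real d - 1))"
    define q where "q = real d / (real d - 1)"
    have "1 + a * t / real d = q" using 3 by (simp add: t_def q_def field_simps)
    with ge'[of t] have "K * t \<le> p * q ^ d" using 3 by (simp add: t_def)
    also have "q ^ d = q * q ^ (d - 1)" using d by (simp add: power_eq_if)
    also have "K * t = K * q / a" by (simp add: t_def q_def)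
    finally have "K * q / a \<le> p * (q * q ^ (d - 1))" .
    moreover have q: "q > 0" using 3 by (simp add: q_def)
    ultimately have "K \<le> (a * p) * q ^ (d - 1)"
      using 3 by (simp add: field_simps)
    moreover have "gurvits_factor d = inverse (q ^ (d - 1))"
      by (simp add: gurvits_factor_def q_def flip: power_inverse)
    ultimately show ?thesis using q by (simp add: deriv divide_le_eq mult.commute flip: divide_inverse)
  qed
qed

section \<open>Stable multiaffine polynomials\<close>

text \<open>Coefficients are indexed by the variable set of the monomial. The value type is left
  open so that the same real coefficients can be evaluated at real and at complex points.\<close>

definition multiaffine :: "('i::finite set \<Rightarrow> real) \<Rightarrow> ('i \<Rightarrow> 'a::real_field) \<Rightarrow> 'a" where
  "multiaffine c y = (\<Sum>A\<in>UNIV. of_real (c A) * prod y A)"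

definition homogeneous_coeffs :: "nat \<Rightarrow> ('i::finite set \<Rightarrow> real) \<Rightarrow> bool" where
  "homogeneous_coeffs m c \<longleftrightarrow> (\<forall>A. c A \<noteq> 0 \<longrightarrow> card A = m)"

text \<open>The coefficients of the derivative along \<open>v\<close> of the polynomial with coefficients \<open>c\<close>.\<close>

definition dir_coeffs :: "('i::finite \<Rightarrow> real) \<Rightarrow> ('i set \<Rightarrow> real) \<Rightarrow> 'i set \<Rightarrow> real" where
  "dir_coeffs v c A = (\<Sum>i\<in>-A. v i * c (insert i A))"

definition line_poly :: "('i::finite set \<Rightarrow> real) \<Rightarrow> ('i \<Rightarrow> 'a::real_field) \<Rightarrow> ('i \<Rightarrow> 'a) \<Rightarrow> 'a poly" where
  "line_poly c y v = (\<Sum>A\<in>UNIV. smult (of_real (c A)) (\<Prod>i\<in>A. [:y i, v i:]))"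

text \<open>The closed form of stability: unlike nonvanishing on the open half-plane, it also makes sense
  for the zero polynomial and for boundary points.\<close>

definition halfplane_bound :: "('i::finite set \<Rightarrow> real) \<Rightarrow> bool" where
  "halfplane_bound c \<longleftrightarrow> (\<forall>y. (\<forall>i. Re (y i) \<ge> 0) \<longrightarrow>
     multiaffine c (\<lambda>i. Re (y i)) \<le> norm (multiaffine c y))"

section \<open>Restriction to lines, directional derivatives, homogeneity and positivity\<close>

lemma poly_line_poly: "poly (line_poly c y v) t = multiaffine c (\<lambda>i. y i + t * v i)"
  by (simp add: line_poly_def multiaffine_def poly_sum poly_prod)

text \<open>In each monomial only variables with \<open>v i \<noteq> 0\<close> raise the degree, and
  there are \<open>m\<close> variables in all. Hence the two choices of \<open>d\<close>: the number
  of variables left or the column sparsity.\<close>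

lemma degree_line_poly:
  assumes "homogeneous_coeffs m c" "card {i. v i \<noteq> 0} \<le> d \<or> m \<le> d"
  shows "degree (line_poly c y v) \<le> d"
  unfolding line_poly_def
proof (rule degree_sum_le)
  fix A :: "'a set"
  have "degree (\<Prod>i\<in>A. [:y i, v i:]) \<le> (\<Sum>i\<in>A. degree [:y i, v i:])"
    using degree_prod_sum_le[of A "\<lambda>i. [:y i, v i:]"] by (simp add: o_def)
  also have "\<dots> = (\<Sum>i\<in>A. if v i \<noteq> 0 then 1 else 0)"
    by (intro sum.cong) auto
  also have "\<dots> = card {i\<in>A. v i \<noteq> 0}"
    by (simp flip: sum.inter_filter)
  finally have deg: "degree (\<Prod>i\<in>A. [:y i, v i:]) \<le> card {i\<in>A. v i \<noteq> 0}" .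
  have "card {i\<in>A. v i \<noteq> 0} \<le> card {i. v i \<noteq> 0}" "card {i\<in>A. v i \<noteq> 0} \<le> card A"
    by (auto intro: card_mono)
  with deg assms show "degree (smult (of_real (c A)) (\<Prod>i\<in>A. [:y i, v i:])) \<le> d"
    by (cases "c A = 0") (auto simp: homogeneous_coeffs_def)
qed simp

text \<open>Product rule: a pair \<open>(A, i)\<close> with \<open>i\<close> outside
  \<open>A\<close> stands for the monomial \<open>insert i A\<close> with its factor
  \<open>i\<close> removed.\<close>

lemma multiaffine_dir_coeffs:
  "multiaffine (dir_coeffs v c) y = (\<Sum>A\<in>UNIV. of_real (c A) * (\<Sum>i\<in>A. prod y (A - {i}) * of_real (v i)))"
proof -
  have "multiaffine (dir_coeffs v c) y =
      (\<Sum>(A, i)\<in>(SIGMA A:UNIV. -A). of_real (c (insert i A)) * (prod y A * of_real (v i)))"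
    by (simp add: multiaffine_def dir_coeffs_def sum_distrib_left sum_distrib_right sum.Sigma mult_ac)
  also have "\<dots> = (\<Sum>(A, i)\<in>(SIGMA A:UNIV. A). of_real (c A) * (prod y (A - {i}) * of_real (v i)))"
    by (rule sum.reindex_bij_witness[where i = "\<lambda>(A, i). (A - {i}, i)" and j = "\<lambda>(A, i). (insert i A, i)"])
       (auto simp: insert_absorb)
  also have "\<dots> = (\<Sum>A\<in>UNIV. of_real (c A) * (\<Sum>i\<in>A. prod y (A - {i}) * of_real (v i)))"
    by (simp add: sum_distrib_left sum.Sigma)
  finally show ?thesis .
qed

lemma pderiv_sum: "pderiv (sum f A) = (\<Sum>a\<in>A. pderiv (f a))"
  using higher_pderiv_sum[of 1 f A] by simp

lemma pderiv_line_poly_0: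
  "poly (pderiv (line_poly c y (\<lambda>i. of_real (v i)))) 0 = multiaffine (dir_coeffs v c) y"
  by (simp add: line_poly_def multiaffine_dir_coeffs pderiv_sum pderiv_smult pderiv_prod
      poly_sum poly_prod pderiv_pCons mult.commute)

lemma dir_coeffs_nonneg:
  assumes "\<And>i. v i \<ge> 0" "\<And>A. c A \<ge> 0"
  shows "dir_coeffs v c A \<ge> 0"
  using assms by (auto simp: dir_coeffs_def intro!: sum_nonneg)

lemma homogeneous_dir_coeffs:
  assumes "homogeneous_coeffs m c"
  shows "homogeneous_coeffs (m - 1) (dir_coeffs v c)"
  unfolding homogeneous_coeffs_def
proof (intro allI impI)
  fix A assume "dir_coeffs v c A \<noteq> 0"
  then obtain i where "i \<notin> A" "c (insert i A) \<noteq> 0"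
    unfolding dir_coeffs_def by (auto elim: sum.not_neutral_contains_not_neutral)
  then show "card A = m - 1"
    using assms by (auto simp: homogeneous_coeffs_def)
qed

lemma multiaffine_scale:
  assumes "homogeneous_coeffs m c"
  shows "multiaffine c (\<lambda>i. w * y i) = w ^ m * multiaffine c y"
  unfolding multiaffine_def sum_distrib_left
proof (rule sum.cong)
  fix A
  show "of_real (c A) * (\<Prod>i\<in>A. w * y i) = w ^ m * (of_real (c A) * prod y A)"
    using assms by (cases "c A = 0") (auto simp: homogeneous_coeffs_def prod.distrib)
qed simp

lemma multiaffine_of_real:
  "multiaffine c (\<lambda>i. of_real (x i)) = of_real (multiaffine c x)"
  by (simp add: multiaffine_def)

lemma multiaffine_mono:
  fixes x x' :: "'i::finite \<Rightarrow> real"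
  assumes "\<And>A. c A \<ge> 0" "\<And>i. 0 \<le> x i" "\<And>i. x i \<le> x' i"
  shows "multiaffine c x \<le> multiaffine c x'"
  unfolding multiaffine_def using assms by (auto intro!: sum_mono mult_left_mono prod_mono)

lemma multiaffine_nonneg:
  fixes x :: "'i::finite \<Rightarrow> real"
  assumes "\<And>A. c A \<ge> 0" "\<And>i. 0 \<le> x i"
  shows "multiaffine c x \<ge> 0"
  unfolding multiaffine_def using assms by (auto intro!: sum_nonneg mult_nonneg_nonneg prod_nonneg)

lemma multiaffine_pos:
  fixes x :: "'i::finite \<Rightarrow> real"
  assumes "\<And>A. c A \<ge> 0" "\<And>i. 0 < x i" "c B \<noteq> 0"
  shows "multiaffine c x > 0"
proof -
  have "0 < of_real (c B) * prod x B"
    using assms(3) by (intro mult_pos_pos prod_pos) (auto simp: assms order.not_eq_order_implies_strict)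
  also have "\<dots> \<le> multiaffine c x"
    unfolding multiaffine_def
    by (intro member_le_sum mult_nonneg_nonneg prod_nonneg) (simp_all add: assms less_imp_le)
  finally show ?thesis .
qed

text \<open>The left-hand side keeps the terms of degree at most 1 in \<open>v\<close>; all others
  are nonnegative.\<close>

lemma prod_add_ge:
  fixes x v :: "'i \<Rightarrow> real"
  assumes "finite A" "\<And>i. x i \<ge> 0" "\<And>i. v i \<ge> 0"
  shows "prod x A + (\<Sum>i\<in>A. prod x (A - {i}) * v i) \<le> (\<Prod>i\<in>A. x i + v i)"
  using assms(1)
proof (induction A rule: finite_induct)
  case (insert a A)
  have *: "(\<Sum>i\<in>A. prod x (insert a A - {i}) * v i) = x a * (\<Sum>i\<in>A. prod x (A - {i}) * v i)"
    unfolding sum_distrib_left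
  proof (rule sum.cong)
    fix i assume "i \<in> A"
    with insert.hyps have "insert a A - {i} = insert a (A - {i})" by auto
    with insert.hyps show "prod x (insert a A - {i}) * v i = x a * (prod x (A - {i}) * v i)"
      by simp
  qed simp
  have "prod x A \<le> (\<Prod>i\<in>A. x i + v i)"
    using assms by (intro prod_mono) auto
  hence "v a * prod x A \<le> v a * (\<Prod>i\<in>A. x i + v i)"
    using assms by (intro mult_left_mono)
  moreover have "x a * (prod x A + (\<Sum>i\<in>A. prod x (A - {i}) * v i)) \<le> x a * (\<Prod>i\<in>A. x i + v i)"
    using assms insert.IH by (intro mult_left_mono)
  ultimately show ?case
    using insert.hyps * by (simp add: algebra_simps)
qed simp

text \<open>At least linear growth along a nonnegative direction, which later excludes a constant
  restriction to a line.\<close>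

lemma multiaffine_add_ge:
  fixes x v :: "'i::finite \<Rightarrow> real"
  assumes "\<And>A. c A \<ge> 0" "\<And>i. x i \<ge> 0" "\<And>i. v i \<ge> 0" "t \<ge> 0"
  shows "t * multiaffine (dir_coeffs v c) x \<le> multiaffine c (\<lambda>i. x i + t * v i)"
proof -
  have "t * (\<Sum>i\<in>A. prod x (A - {i}) * v i) \<le> (\<Prod>i\<in>A. x i + t * v i)" for A
  proof -
    have "t * (\<Sum>i\<in>A. prod x (A - {i}) * v i) = (\<Sum>i\<in>A. prod x (A - {i}) * (t * v i))"
      by (simp add: sum_distrib_left mult_ac)
    also have "\<dots> \<le> prod x A + \<dots>"
      using assms by (auto intro: prod_nonneg)
    also have "\<dots> \<le> (\<Prod>i\<in>A. x i + t * v i)"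
      using assms by (intro prod_add_ge) auto
    finally show ?thesis .
  qed
  thus ?thesis
    unfolding multiaffine_dir_coeffs
    using assms unfolding multiaffine_def sum_distrib_left[of t] mult.left_commute[of t]
    by (intro sum_mono mult_left_mono) auto
qed

section \<open>Stability and its inheritance by derivatives\<close>

text \<open>By homogeneity, every root \<open>u\<close> of \<open>u \<mapsto> multiaffine c (Re y + \<i> u Im y)\<close> satisfies
  \<open>Re u \<le> 0\<close>; comparing the values at \<open>u = 0\<close> and \<open>u = 1\<close> gives the bound.\<close>

lemma halfplane_boundI:
  assumes hom: "homogeneous_coeffs m c"
    and nz: "\<And>y :: 'i::finite \<Rightarrow> complex. (\<And>i. Re (y i) > 0) \<Longrightarrow> multiaffine c y \<noteq> 0"
  shows "halfplane_bound c"
proof -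
  have bound_open: "multiaffine c (\<lambda>i. Re (y i)) \<le> norm (multiaffine c y)"
    if y: "\<And>i. Re (y i) > 0" for y :: "'i \<Rightarrow> complex"
  proof -
    let ?x = "\<lambda>i. complex_of_real (Re (y i))" and ?z = "\<lambda>i. \<i> * complex_of_real (Im (y i))"
    let ?P = "line_poly c ?x ?z"
    have "Re r \<le> 0" if "poly ?P r = 0" for r
    proof (rule ccontr)
      assume r: "\<not> Re r \<le> 0"
      \<comment> \<open>Dividing the zero by \<open>r\<close> gives \<open>?x i / r + ?z i\<close>,
        where \<open>?z i\<close> is imaginary and \<open>?x i / r\<close> has positive real
        part.\<close>
      have "multiaffine c (\<lambda>i. 1 / r * (?x i + r * ?z i)) = 0"
        using that by (simp only: multiaffine_scale[OF hom] poly_line_poly mult_zero_right)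
      moreover have "Re (1 / r * (?x i + r * ?z i)) > 0" for i
      proof -
        have "r \<noteq> 0" using r by auto
        hence "1 / r * (?x i + r * ?z i) = ?x i / r + ?z i" by (simp add: field_simps)
        hence "Re (1 / r * (?x i + r * ?z i)) = Re (y i) * Re r / (norm r)\<^sup>2"
          by (simp add: Re_divide cmod_power2)
        thus ?thesis using r y[of i] \<open>r \<noteq> 0\<close> by simp
      qed
      ultimately show False using nz[of "\<lambda>i. 1 / r * (?x i + r * ?z i)"] by blast
    qed
    hence "norm (poly ?P 0) \<le> norm (poly ?P 1)"
      by (rule norm_poly_0_le_norm_poly_1)
    moreover have "(\<lambda>i. ?x i + ?z i) = y"
      by (intro ext) (simp add: complex_eq_iff)
    ultimately have "norm (multiaffine c ?x) \<le> norm (multiaffine c y)"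
      by (simp add: poly_line_poly)
    thus ?thesis by (simp add: multiaffine_of_real)
  qed
  show ?thesis
    unfolding halfplane_bound_def
  proof (intro allI impI)
    fix y :: "'i \<Rightarrow> complex" assume y: "\<forall>i. Re (y i) \<ge> 0"
    \<comment> \<open>Boundary points are limits of points shifted by \<open>e > 0\<close> into the
      open half-plane.\<close>
    have "((\<lambda>e. multiaffine c (\<lambda>i. Re (y i) + e)) \<longlongrightarrow> multiaffine c (\<lambda>i. Re (y i) + 0)) (at_right 0)"
      unfolding multiaffine_def by (intro tendsto_intros)
    moreover have "((\<lambda>e. norm (multiaffine c (\<lambda>i. y i + complex_of_real e))) \<longlongrightarrow>
        norm (multiaffine c (\<lambda>i. y i + complex_of_real 0))) (at_right 0)"
      unfolding multiaffine_def by (intro tendsto_intros)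
    moreover have "\<forall>\<^sub>F e in at_right 0. multiaffine c (\<lambda>i. Re (y i) + e) \<le>
        norm (multiaffine c (\<lambda>i. y i + complex_of_real e))"
    proof (rule eventually_at_right_less[THEN eventually_mono])
      fix e :: real assume "0 < e"
      thus "multiaffine c (\<lambda>i. Re (y i) + e) \<le> norm (multiaffine c (\<lambda>i. y i + complex_of_real e))"
        using bound_open[of "\<lambda>i. y i + complex_of_real e"] y by (simp add: add_nonneg_pos)
    qed
    ultimately have "multiaffine c (\<lambda>i. Re (y i) + 0) \<le> norm (multiaffine c (\<lambda>i. y i + complex_of_real 0))"
      by (intro tendsto_le[OF trivial_limit_at_right_real])
    thus "multiaffine c (\<lambda>i. Re (y i)) \<le> norm (multiaffine c y)" by simp
  qed
qed

text \<open>Gauss-Lucas: on the line through a point \<open>y\<close> of the open half-plane in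
  direction \<open>v\<close>, all roots lie in the open left half-plane, so the logarithmic
  derivative at \<open>y\<close> cannot vanish. A zero derivative satisfies the bound
  trivially.\<close>

lemma halfplane_bound_dir_coeffs:
  assumes hom: "homogeneous_coeffs m c" and c: "\<And>A. c A \<ge> 0" and bound: "halfplane_bound c"
    and v: "\<And>i. v i \<ge> 0"
  shows "halfplane_bound (dir_coeffs v c)"
proof (cases "\<forall>A. dir_coeffs v c A = 0")
  case True
  then show ?thesis by (simp add: halfplane_bound_def multiaffine_def)
next
  case False
  then obtain A where A: "dir_coeffs v c A \<noteq> 0" by blast
  then obtain B where B: "c B \<noteq> 0"
    unfolding dir_coeffs_def by (metis (no_types, lifting) mult_zero_right sum.neutral)
  show ?thesis
  proof (rule halfplane_boundI[OF homogeneous_dir_coeffs[OF hom]])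
    fix y :: "'a \<Rightarrow> complex" assume y: "\<And>i. Re (y i) > 0"
    define x where "x = (\<lambda>i. Re (y i))"
    have x: "x i > 0" for i using y by (simp add: x_def)
    let ?P = "line_poly c y (\<lambda>i. of_real (v i))"
    have P_ge: "multiaffine c (\<lambda>i. x i + Re t * v i) \<le> norm (poly ?P t)" if "Re t \<ge> 0" for t
    proof -
      have "Re (y i + t * of_real (v i)) \<ge> 0" for i
        using that v[of i] y[of i] by simp
      with bound show ?thesis
        unfolding halfplane_bound_def poly_line_poly x_def
        by (auto dest: spec[of _ "\<lambda>i. y i + t * of_real (v i)"])
    qed
    have "Re r < 0" if "poly ?P r = 0" for r
    proof (rule ccontr)
      assume r: "\<not> Re r < 0"
      have "multiaffine c (\<lambda>i. x i + Re r * v i) > 0"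
        using r v x B c by (intro multiaffine_pos) (auto intro!: add_pos_nonneg)
      with P_ge[of r] r that show False by simp
    qed
    \<comment> \<open>A constant restriction would bound a function growing at rate at least
      \<open>D > 0\<close>; \<open>t\<close> is chosen with
      \<open>t * D = norm a + 1\<close>.\<close>
    moreover have "degree ?P > 0"
    proof (rule ccontr)
      assume "\<not> degree ?P > 0"
      then obtain a where a: "?P = [:a:]" by (metis degree_eq_zeroE neq0_conv)
      define D where "D = multiaffine (dir_coeffs v c) x"
      have D: "D > 0"
        unfolding D_def using dir_coeffs_nonneg[OF v c] x A by (intro multiaffine_pos)
      define t where "t = (norm a + 1) / D"
      have t: "t \<ge> 0" using D by (simp add: t_def)
      have "t * D \<le> multiaffine c (\<lambda>i. x i + t * v i)"
        unfolding D_def using c v x t by (intro multiaffine_add_ge) (auto intro: less_imp_le)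
      also have "\<dots> \<le> norm a"
        using P_ge[of "of_real t"] t a by simp
      finally show False using D by (simp add: t_def)
    qed
    ultimately have "Re (poly (pderiv ?P) 0 / poly ?P 0) > 0"
      by (rule Re_log_deriv_pos)
    thus "multiaffine (dir_coeffs v c) y \<noteq> 0"
      by (auto simp: pderiv_line_poly_0)
  qed
qed

section \<open>Real-rooted restrictions and the bound for one derivative\<close>

text \<open>A root \<open>r\<close> off the negative axis can be rotated into a zero of \<open>multiaffine c\<close> in the open right half-plane
  by multiplying all the variables by \<open>1 / csqrt r\<close>.\<close>

lemma line_poly_negative_roots:
  assumes hom: "homogeneous_coeffs m c" and c: "\<And>A. c A \<ge> 0" and bound: "halfplane_bound c"
    and y: "\<And>i. y i \<ge> 0" and v: "\<And>i. v i \<ge> 0" and pos: "multiaffine c y > 0"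
    and root: "poly (line_poly c (\<lambda>i. of_real (y i)) (\<lambda>i. of_real (v i))) r = (0 :: complex)"
  shows "\<exists>b>0. r = - complex_of_real b"
proof (rule ccontr)
  assume nex: "\<not> ?thesis"
  have "r \<noteq> 0"
    using root pos by (auto simp: poly_line_poly multiaffine_of_real)
  define w where "w = csqrt r"
  have w2: "w\<^sup>2 = r" and w0: "w \<noteq> 0" using \<open>r \<noteq> 0\<close> by (auto simp: w_def)
  \<comment> \<open>The principal root has \<open>Re w \<ge> 0\<close>, and \<open>Re w = 0\<close>
    would make \<open>r\<close> a negative real.\<close>
  have Re_w: "Re w > 0"
  proof (rule ccontr)
    assume "\<not> Re w > 0"
    hence "Re w = 0" using csqrt_principal[of r] by (auto simp: w_def)
    hence "w = \<i> * of_real (Im w)" by (simp add: complex_eq_iff)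
    hence "r = - of_real ((Im w)\<^sup>2)"
      using w2 by (metis mult_minus1 of_real_power power_mult_distrib power2_i)
    moreover have "(Im w)\<^sup>2 > 0" using w0 \<open>Re w = 0\<close> by (simp add: complex_eq_iff)
    ultimately show False using nex by blast
  qed
  define u where "u = 1 / w"
  have Re_u: "Re u > 0" using Re_w w0 by (simp add: u_def Re_divide cmod_power2[symmetric])
  define z where "z = (\<lambda>i. u * (of_real (y i) + r * of_real (v i)))"
  have z_eq: "z i = u * of_real (y i) + w * of_real (v i)" for i
    using w0 by (simp add: z_def u_def w2[symmetric] field_simps power2_eq_square)
  have z: "Re (z i) = Re u * y i + Re w * v i" for i
    by (simp add: z_eq)
  \<comment> \<open>Since \<open>y\<close> and \<open>v\<close> are only nonnegative,
    \<open>z\<close> may lie on the boundary. The closed bound still applies there, and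
    \<open>Re (z i) \<ge> Re u * y i\<close> makes it positive.\<close>
  have "0 < Re u ^ m * multiaffine c y" using Re_u pos by simp
  also have "\<dots> = multiaffine c (\<lambda>i. Re u * y i)"
    by (simp add: multiaffine_scale[OF hom])
  also have "\<dots> \<le> multiaffine c (\<lambda>i. Re (z i))"
    using Re_u Re_w y v c by (intro multiaffine_mono) (auto simp: z)
  also have "\<dots> \<le> norm (multiaffine c z)"
  proof -
    have "Re (z i) \<ge> 0" for i using Re_u Re_w y v by (simp add: z)
    thus ?thesis using bound unfolding halfplane_bound_def by blast
  qed
  also have "multiaffine c z = 0"
    using root by (simp add: z_def multiaffine_scale[OF hom] poly_line_poly)
  finally show False by simp
qed

lemma gurvits_factor_le_1: "gurvits_factor d \<le> 1"
  unfolding gurvits_factor_def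
  by (cases "d = 0") (auto intro!: power_le_one simp: divide_le_eq simp del: power_divide)

text \<open>One differentiation step: the univariate bound applied to the restriction to the line
  through \<open>y\<close> in direction \<open>v\<close>.\<close>

lemma multiaffine_dir_ge:
  fixes y v :: "'i::finite \<Rightarrow> real"
  assumes hom: "homogeneous_coeffs m c" and c: "\<And>A. c A \<ge> 0" and bound: "halfplane_bound c"
    and y: "\<And>i. y i \<ge> 0" and v: "\<And>i. v i \<ge> 0"
    and d: "card {i. v i \<noteq> 0} \<le> d \<or> m \<le> d" "d \<ge> 1" and K: "K \<ge> 0"
    and ge: "\<And>t. t > 0 \<Longrightarrow> K * t \<le> multiaffine c (\<lambda>i. y i + t * v i)"
  shows "gurvits_factor d * K \<le> multiaffine (dir_coeffs v c) y"
proof (cases "multiaffine c y = 0")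
  \<comment> \<open>A root at 0 is not negative. Here \<open>P(t) = t Q(t)\<close>, and
    \<open>P'(0) = Q(0)\<close> is a limit of values at least \<open>K\<close>, so the bound holds
    even with factor 1.\<close>
  case True
  define P where "P = line_poly c y v"
  have "poly P 0 = 0" using True by (simp add: P_def poly_line_poly)
  then obtain Q where Q: "P = [:0, 1:] * Q"
    by (auto simp: poly_eq_0_iff_dvd dvd_def)
  have "K \<le> poly Q t" if "t > 0" for t
    using ge[OF that] that unfolding poly_line_poly[symmetric] P_def[symmetric] Q
    by (simp add: mult.commute)
  hence "\<forall>\<^sub>F t in at_right 0. K \<le> poly Q t"
    using eventually_at_right_less[of "0::real"] by (auto elim: eventually_mono)
  moreover have "(poly Q \<longlongrightarrow> poly Q 0) (at_right 0)"
    by (intro tendsto_intros)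
  ultimately have "K \<le> poly Q 0"
    by (intro tendsto_lowerbound) auto
  also have "\<dots> = poly (pderiv P) 0"
    unfolding Q pderiv_mult by (simp add: pderiv_pCons)
  also have "\<dots> = multiaffine (dir_coeffs v c) y"
    using pderiv_line_poly_0[of c y v] by (simp add: P_def)
  finally show ?thesis
    using mult_right_mono[OF gurvits_factor_le_1[of d] K] by simp
next
  case False
  hence pos: "multiaffine c y > 0"
    using multiaffine_nonneg[OF c y] by (simp add: less_le)
  define P where "P = line_poly c (\<lambda>i. complex_of_real (y i)) (\<lambda>i. of_real (v i))"
  have "gurvits_factor d * K \<le> norm (poly (pderiv P) 0)"
  proof (rule negative_roots_deriv_ge)
    show "\<exists>b>0. r = - complex_of_real b" if "poly P r = 0" for r
      using line_poly_negative_roots[OF hom c bound y v pos] that by (simp add: P_def)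
    show "degree P \<le> d"
      unfolding P_def using d by (intro degree_line_poly[OF hom]) auto
    fix t :: real assume t: "t > 0"
    have "poly P (of_real t) = of_real (multiaffine c (\<lambda>i. y i + t * v i))"
      by (simp add: P_def poly_line_poly flip: multiaffine_of_real)
    thus "K * t \<le> norm (poly P (of_real t))"
      using ge[OF t] by simp
  qed (use d K in auto)
  also have "poly (pderiv P) 0 = of_real (multiaffine (dir_coeffs v c) y)"
    by (simp add: P_def pderiv_line_poly_0 multiaffine_of_real)
  finally show ?thesis
    using multiaffine_nonneg[of "dir_coeffs v c" y] dir_coeffs_nonneg[of v c] v c y by simp
qed

section \<open>Capacity and permanent\<close>

text \<open>The coefficients of the derivative of \<open>\<Prod>\<^sub>i y\<^sub>i\<close> along all the columns in \<open>T\<close>; the derivative along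
  column \<open>j\<close> removes the factor \<open>y\<close> with index \<open>g j\<close>.\<close>

definition column_coeffs :: "real^'n^'n \<Rightarrow> 'n set \<Rightarrow> 'n set \<Rightarrow> real" where
  "column_coeffs M T A = (\<Sum>g | g \<in> T \<rightarrow>\<^sub>E UNIV \<and> inj_on g T \<and> g ` T = -A. \<Prod>j\<in>T. M $ g j $ j)"

lemma column_coeffs_nonneg:
  assumes "\<And>i j. M $ i $ j \<ge> 0"
  shows "column_coeffs M T A \<ge> 0"
  using assms by (auto simp: column_coeffs_def intro!: sum_nonneg prod_nonneg)

lemma homogeneous_column_coeffs:
  fixes M :: "real^'n^'n"
  shows "homogeneous_coeffs (CARD('n) - card T) (column_coeffs M T)"
  unfolding homogeneous_coeffs_def
proof (intro allI impI)
  fix A assume "column_coeffs M T A \<noteq> 0"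
  then obtain g where g: "inj_on g T" "g ` T = -A"
    unfolding column_coeffs_def by (auto elim: sum.not_neutral_contains_not_neutral)
  hence "card T = CARD('n) - card A"
    using card_image[OF g(1)] by (simp add: Compl_eq_Diff_UNIV card_Diff_subset)
  thus "card A = CARD('n) - card T"
    using card_mono[of UNIV A] by simp
qed

lemma column_coeffs_empty: "column_coeffs M {} = (\<lambda>A. if A = UNIV then 1 else 0)"
proof
  fix A :: "'a set"
  have "{g :: 'a \<Rightarrow> 'a. g \<in> {} \<rightarrow>\<^sub>E UNIV \<and> inj_on g {} \<and> g ` {} = -A} =
      (if A = UNIV then {\<lambda>_. undefined} else {})"
    by auto
  then show "column_coeffs M {} A = (if A = UNIV then 1 else 0)"
    by (simp add: column_coeffs_def)
qed

lemma multiaffine_single: "multiaffine (\<lambda>A. if A = B then a else 0) y = of_real a * prod y B"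
proof -
  have "multiaffine (\<lambda>A. if A = B then a else 0) y =
      (\<Sum>A\<in>{B}. of_real (if A = B then a else 0) * prod y A)"
    unfolding multiaffine_def by (rule sum.mono_neutral_right) auto
  thus ?thesis by simp
qed

text \<open>Laplace expansion along column \<open>s\<close>.\<close>

lemma column_coeffs_insert:
  fixes M :: "real^'n^'n"
  assumes "s \<notin> T"
  shows "column_coeffs M (insert s T) = dir_coeffs (\<lambda>i. M $ i $ s) (column_coeffs M T)"
proof
  fix A
  let ?G = "\<lambda>T A. {g :: 'n \<Rightarrow> 'n. g \<in> T \<rightarrow>\<^sub>E UNIV \<and> inj_on g T \<and> g ` T = -A}"
  have fin: "finite (?G T A)" for A
    by (rule finite_subset[OF _ finite_PiE[of T "\<lambda>_. UNIV"]]) auto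
  have "dir_coeffs (\<lambda>i. M $ i $ s) (column_coeffs M T) A =
      (\<Sum>(i, g)\<in>(SIGMA i:-A. ?G T (insert i A)). M $ i $ s * (\<Prod>j\<in>T. M $ g j $ j))"
    using fin by (simp add: dir_coeffs_def column_coeffs_def sum_distrib_left sum.Sigma)
  also have "\<dots> = (\<Sum>g\<in>?G (insert s T) A. \<Prod>j\<in>insert s T. M $ g j $ j)"
  \<comment> \<open>An injection on \<open>insert s T\<close> is one on \<open>T\<close> together
    with its value at \<open>s\<close>; resetting that value to \<open>undefined\<close> keeps the
    restriction extensional.\<close>
  proof (rule sum.reindex_bij_witness[where i = "\<lambda>g. (g s, g(s := undefined))"
        and j = "\<lambda>(i, g). g(s := i)"], goal_cases)
    case (1 a)
    then show ?case using assms by (auto simp: PiE_def extensional_def)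
  next
    case (2 a)
    obtain i g where a: "a = (i, g)" by (cases a)
    with 2 have g: "i \<in> -A" "g \<in> T \<rightarrow>\<^sub>E UNIV" "inj_on g T" "g ` T = -insert i A" by auto
    have "(g(s := i)) ` T = g ` T" "inj_on (g(s := i)) T \<longleftrightarrow> inj_on g T"
      using assms by (auto intro!: image_cong inj_on_cong)
    with g assms show ?case by (auto simp: a PiE_def extensional_def)
  next
    case (3 g)
    then show ?case by (auto simp: fun_eq_iff)
  next
    case (4 g)
    hence g: "g \<in> insert s T \<rightarrow>\<^sub>E UNIV" "inj_on g (insert s T)" "g ` insert s T = -A" by auto
    have "(g(s := undefined)) ` T = g ` T" "inj_on (g(s := undefined)) T \<longleftrightarrow> inj_on g T"
      using assms by (auto intro!: image_cong inj_on_cong)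
    moreover have "g ` T = - insert (g s) A"
      using g assms by (auto simp: inj_on_def)
    ultimately show ?case using g by (auto simp: PiE_def extensional_def)
  next
    case (5 a)
    obtain i g where "a = (i, g)" by (cases a)
    moreover have "(\<Prod>j\<in>T. M $ (g(s := i)) j $ j) = (\<Prod>j\<in>T. M $ g j $ j)"
      using assms by (intro prod.cong) auto
    ultimately show ?case using assms by simp
  qed
  finally show "column_coeffs M (insert s T) A = dir_coeffs (\<lambda>i. M $ i $ s) (column_coeffs M T) A"
    by (simp add: column_coeffs_def)
qed

text \<open>\<open>permanent\<close> sums over maps from rows to columns,
  \<open>column_coeffs\<close> over maps from columns to rows; inverting the permutation exchanges
  them.\<close>

lemma permanent_eq_column_coeffs:
  fixes M :: "real^'n^'n"
  shows "permanent M = column_coeffs M UNIV {}"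
proof -
  have "(\<Prod>i\<in>UNIV. M $ i $ \<sigma> i) = (\<Prod>j\<in>UNIV. M $ inv \<sigma> j $ j)" if "\<sigma> permutes UNIV" for \<sigma>
    using prod.permute[OF that, of "\<lambda>j. M $ inv \<sigma> j $ j"] permutes_inverses[OF that]
    by (simp add: o_def)
  hence "permanent M = (\<Sum>\<sigma> | \<sigma> permutes UNIV. \<Prod>j\<in>UNIV. M $ inv \<sigma> j $ j)"
    by (simp add: permanent_def)
  also have "\<dots> = (\<Sum>\<sigma> | \<sigma> permutes UNIV. \<Prod>j\<in>UNIV. M $ \<sigma> j $ j)"
    by (rule sum_permutations_inverse[of "\<lambda>\<sigma>. \<Prod>j\<in>UNIV. M $ \<sigma> j $ j", symmetric])
  also have "\<dots> = column_coeffs M UNIV {}"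
  proof -
    have "\<sigma> permutes UNIV \<longleftrightarrow> bij \<sigma>" for \<sigma> :: "'n \<Rightarrow> 'n"
      by (metis UNIV_I bij_imp_permutes permutes_bij)
    hence "{\<sigma> :: 'n \<Rightarrow> 'n. \<sigma> permutes UNIV} = {g \<in> UNIV \<rightarrow>\<^sub>E UNIV. inj g \<and> range g = - {}}"
      by (simp add: bij_def)
    thus ?thesis by (simp only: column_coeffs_def mem_Collect_eq)
  qed
  finally show ?thesis .
qed

text \<open>For the product of all variables the bound is \<open>Re z \<le> norm z\<close> in each
  factor; every further column is a nonnegative direction.\<close>

lemma halfplane_bound_column_coeffs:
  assumes "\<And>i j. M $ i $ j \<ge> 0"
  shows "halfplane_bound (column_coeffs M T)"
  using finite[of T]
proof (induction T rule: finite_induct)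
  case empty
  have *: "multiaffine (column_coeffs M {}) y = prod y UNIV" for y :: "_ \<Rightarrow> 'b::real_field"
    by (simp add: column_coeffs_empty multiaffine_single)
  show ?case
    unfolding halfplane_bound_def *
    by (auto simp: prod_norm[symmetric] intro!: prod_mono complex_Re_le_cmod)
next
  case (insert s T)
  then show ?case
    using assms unfolding column_coeffs_insert[OF insert.hyps(2)]
    by (intro halfplane_bound_dir_coeffs[OF homogeneous_column_coeffs column_coeffs_nonneg])
qed

section \<open>Comparing permanent and capacity\<close>

lemma row_product_poly_nonneg:
  assumes "\<And>i j. M $ i $ j \<ge> 0" "\<And>j. y $ j \<ge> 0"
  shows "row_product_poly M y \<ge> 0"
  unfolding row_product_poly_def using assms by (auto intro!: prod_nonneg sum_nonneg)

text \<open>Expanding the row product gives one nonnegative term for each map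
  \<open>\<sigma>\<close>; the permutations alone contribute the permanent, because the
  \<open>y $ i\<close> have product 1.\<close>

lemma permanent_le_capacity:
  fixes M :: "real^'n^'n"
  assumes M: "\<And>i j. M $ i $ j \<ge> 0"
  shows "permanent M \<le> capacity (row_product_poly M)"
  unfolding capacity_def
proof (rule cInf_greatest)
  show "{row_product_poly M y |y. (\<forall>i. 0 \<le> y $ i) \<and> (\<Prod>i\<in>UNIV. y $ i) = 1} \<noteq> {}"
    by (auto intro!: exI[of _ "\<chi> i. 1"])
  fix p assume "p \<in> {row_product_poly M y |y. (\<forall>i. 0 \<le> y $ i) \<and> (\<Prod>i\<in>UNIV. y $ i) = 1}"
  then obtain y where y: "p = row_product_poly M y" "\<And>i. y $ i \<ge> 0" "(\<Prod>i\<in>UNIV. y $ i) = 1"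
    by auto
  have "(\<Prod>i\<in>UNIV. M $ i $ \<sigma> i * y $ \<sigma> i) = (\<Prod>i\<in>UNIV. M $ i $ \<sigma> i)" if "\<sigma> permutes UNIV" for \<sigma>
    using prod.permute[OF that, of "\<lambda>i. y $ i"] y(3) by (simp add: prod.distrib o_def)
  hence "permanent M = (\<Sum>\<sigma> | \<sigma> permutes UNIV. \<Prod>i\<in>UNIV. M $ i $ \<sigma> i * y $ \<sigma> i)"
    by (simp add: permanent_def)
  also have "\<dots> \<le> (\<Sum>\<sigma>\<in>UNIV \<rightarrow>\<^sub>E UNIV. \<Prod>i\<in>UNIV. M $ i $ \<sigma> i * y $ \<sigma> i)"
    using M y(2) by (intro sum_mono2 finite_PiE) (auto intro!: prod_nonneg)
  also have "\<dots> = p"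
    by (simp add: y(1) row_product_poly_def prod_sum_PiE)
  finally show "permanent M \<le> p" .
qed

lemma capacity_nonneg:
  assumes "\<And>i j. M $ i $ j \<ge> 0"
  shows "capacity (row_product_poly M) \<ge> 0"
  unfolding capacity_def
  by (rule cInf_greatest) (auto intro!: exI[of _ "\<chi> i. 1"] row_product_poly_nonneg assms)

text \<open>By homogeneity, \<open>x\<close> can be divided by the \<open>CARD('n)\<close>-th root
  of its product.\<close>

lemma capacity_mult_prod_le:
  fixes M :: "real^'n^'n" and x :: "'n \<Rightarrow> real"
  assumes M: "\<And>i j. M $ i $ j \<ge> 0" and x: "\<And>j. x j > 0"
  shows "capacity (row_product_poly M) * prod x UNIV \<le> (\<Prod>i\<in>UNIV. \<Sum>j\<in>UNIV. M $ i $ j * x j)"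
proof -
  define r where "r = root CARD('n) (prod x UNIV)"
  have P: "prod x UNIV > 0" using x by (intro prod_pos) auto
  have r: "r > 0" "r ^ CARD('n) = prod x UNIV" using P by (auto simp: r_def)
  define y :: "real^'n" where "y = (\<chi> j. x j / r)"
  have "capacity (row_product_poly M) \<le> row_product_poly M y"
    unfolding capacity_def
  proof (rule cInf_lower)
    have "(\<Prod>i\<in>UNIV. y $ i) = 1" using r x by (simp add: y_def prod_dividef less_imp_neq[symmetric])
    moreover have "\<forall>i. 0 \<le> y $ i" using r x by (simp add: y_def less_imp_le)
    ultimately show "row_product_poly M y \<in>
        {row_product_poly M y |y. (\<forall>i. 0 \<le> y $ i) \<and> (\<Prod>i\<in>UNIV. y $ i) = 1}" by blast
    show "bdd_below {row_product_poly M y |y. (\<forall>i. 0 \<le> y $ i) \<and> (\<Prod>i\<in>UNIV. y $ i) = 1}"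
      by (rule bdd_belowI[of _ 0]) (auto intro!: row_product_poly_nonneg M)
  qed
  also have "row_product_poly M y = (\<Prod>i\<in>UNIV. (\<Sum>j\<in>UNIV. M $ i $ j * x j) / r)"
    by (simp add: row_product_poly_def y_def sum_divide_distrib)
  also have "\<dots> = (\<Prod>i\<in>UNIV. \<Sum>j\<in>UNIV. M $ i $ j * x j) / prod x UNIV"
    by (simp add: prod_dividef r)
  finally show ?thesis using P by (simp add: pos_le_divide_eq)
qed

lemma gurvits_factor_nonneg: "gurvits_factor d \<ge> 0"
  by (cases "d = 0") (auto simp: gurvits_factor_def)

text \<open>Invariant of the elimination: the variables in \<open>T\<close> have been differentiated
  and set to 0. The index \<open>m\<close> is the number of variables present before a step, so it
  has run from \<open>CARD('n)\<close> down to \<open>CARD('n) - card T + 1\<close>.\<close>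

lemma capacity_column_coeffs:
  fixes M :: "real^'n^'n" and x :: "'n \<Rightarrow> real"
  assumes M: "\<And>i j. M $ i $ j \<ge> 0" and x: "\<And>j. x j > 0"
    and d: "\<And>m. m \<ge> 1 \<Longrightarrow> d m \<ge> 1"
      "\<And>m j. m \<ge> 1 \<Longrightarrow> card {i. M $ i $ j \<noteq> 0} \<le> d m \<or> m \<le> d m"
  shows "capacity (row_product_poly M) * (\<Prod>m\<in>{CARD('n) - card T<..CARD('n)}. gurvits_factor (d m)) *
      prod x (-T) \<le> multiaffine (column_coeffs M T) (\<lambda>i. \<Sum>j\<in>-T. M $ i $ j * x j)"
  using finite[of T] x
proof (induction T arbitrary: x rule: finite_induct)
  case empty
  have "multiaffine (column_coeffs M {}) y = prod y UNIV" for y :: "'n \<Rightarrow> real"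
    by (simp add: column_coeffs_empty multiaffine_single)
  then show ?case
    using capacity_mult_prod_le[OF M empty] by simp
next
  case (insert s T)
  define m where "m = CARD('n) - card T"
  define cap where "cap = capacity (row_product_poly M) * (\<Prod>m\<in>{m<..CARD('n)}. gurvits_factor (d m))"
  define y where "y = (\<lambda>i. \<Sum>j\<in>-insert s T. M $ i $ j * x j)"
  define K where "K = cap * prod x (-insert s T)"
  have "card T < CARD('n)"
    using insert.hyps by (intro psubset_card_mono) auto
  hence m: "m \<ge> 1" by (simp add: m_def)
  have T: "-T = insert s (-insert s T)" using insert.hyps by auto
  have "gurvits_factor (d m) * K \<le> multiaffine (dir_coeffs (\<lambda>i. M $ i $ s) (column_coeffs M T)) y"
  proof (rule multiaffine_dir_ge)
    show "homogeneous_coeffs m (column_coeffs M T)"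
      unfolding m_def by (rule homogeneous_column_coeffs)
    show "halfplane_bound (column_coeffs M T)"
      by (rule halfplane_bound_column_coeffs[OF M])
    show "y i \<ge> 0" for i
      unfolding y_def by (intro sum_nonneg mult_nonneg_nonneg M less_imp_le insert.prems)
    show "K \<ge> 0"
      unfolding K_def cap_def
      by (intro mult_nonneg_nonneg prod_nonneg ballI gurvits_factor_nonneg capacity_nonneg M
          less_imp_le[OF insert.prems])
    \<comment> \<open>The induction hypothesis at \<open>x s = t\<close>: the variable
      \<open>s\<close> moves the row values along column \<open>s\<close>.\<close>
    show "K * t \<le> multiaffine (column_coeffs M T) (\<lambda>i. y i + t * M $ i $ s)" if "t > 0" for t
    proof -
      let ?x = "x(s := t)"
      have "cap * prod ?x (-T) \<le> multiaffine (column_coeffs M T) (\<lambda>i. \<Sum>j\<in>-T. M $ i $ j * ?x j)"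
        unfolding cap_def m_def using that insert.prems by (intro insert.IH) auto
      moreover have "prod ?x (-T) = t * prod x (-insert s T)"
        unfolding T by (subst prod.insert) (auto intro!: prod.cong)
      moreover have "(\<Sum>j\<in>-T. M $ i $ j * ?x j) = y i + t * M $ i $ s" for i
        unfolding T y_def by (subst sum.insert) (auto intro!: sum.cong)
      ultimately show ?thesis by (simp add: K_def mult_ac)
    qed
  qed (use d m M column_coeffs_nonneg[OF M] in auto)
  moreover have "{CARD('n) - card (insert s T)<..CARD('n)} = insert m {m<..CARD('n)}"
    using m insert.hyps by (auto simp: m_def)
  hence "(\<Prod>m\<in>{CARD('n) - card (insert s T)<..CARD('n)}. gurvits_factor (d m)) =
      gurvits_factor (d m) * (\<Prod>m\<in>{m<..CARD('n)}. gurvits_factor (d m))"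
    by simp
  ultimately show ?case
    unfolding column_coeffs_insert[OF insert.hyps(2)] y_def[symmetric]
    by (simp add: K_def cap_def mult_ac)
qed

text \<open>With \<open>T = UNIV\<close> no variables are left, and only the constant coefficient,
  the permanent, survives.\<close>

lemma gurvits_capacity_le_permanent:
  fixes M :: "real^'n^'n"
  assumes M: "\<And>i j. M $ i $ j \<ge> 0"
    and d: "\<And>m. m \<ge> 1 \<Longrightarrow> d m \<ge> 1"
      "\<And>m j. m \<ge> 1 \<Longrightarrow> card {i. M $ i $ j \<noteq> 0} \<le> d m \<or> m \<le> d m"
  shows "(\<Prod>m\<in>{1..CARD('n)}. gurvits_factor (d m)) * capacity (row_product_poly M) \<le> permanent M"
proof -
  have "column_coeffs M UNIV A = (if A = {} then permanent M else 0)" for A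
    using homogeneous_column_coeffs[of UNIV M]
    by (auto simp: permanent_eq_column_coeffs homogeneous_coeffs_def)
  hence "column_coeffs M UNIV = (\<lambda>A. if A = {} then permanent M else 0)" by blast
  hence "multiaffine (column_coeffs M UNIV) (\<lambda>i. 0 :: real) = permanent M"
    by (simp add: multiaffine_single)
  moreover have "{0<..CARD('n)} = {1..CARD('n)}" by auto
  ultimately show ?thesis
    using capacity_column_coeffs[OF M, of "\<lambda>_. 1" d UNIV] d by (simp add: mult.commute)
qed

text \<open>The product telescopes: the factor \<open>(n / (n + 1)) ^ n\<close> replaces the
  denominator \<open>n ^ n\<close> by \<open>(n + 1) ^ n\<close>.\<close>

lemma prod_gurvits_factor: "(\<Prod>m\<in>{1..n}. gurvits_factor m) = fact n / real n ^ n"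
proof (induction n)
  case (Suc n)
  have n: "real n ^ n \<noteq> 0" by (cases n) auto
  have "(\<Prod>m\<in>{1..Suc n}. gurvits_factor m) = fact n / real n ^ n * (real n / real (Suc n)) ^ n"
    using Suc.IH by (simp add: gurvits_factor_def[of "Suc n"])
  also have "\<dots> = fact n / real (Suc n) ^ n"
    using n by (simp add: power_divide)
  also have "\<dots> = fact (Suc n) / real (Suc n) ^ Suc n"
    by (simp add: divide_simps del: of_nat_Suc)
  finally show ?case .
qed simp

section \<open>Comparing the two maximizers\<close>

theorem proposition6:
  fixes C :: "(real^'n^'n) set" and M_perm M_cap :: "real^'n^'n"
  assumes nonneg: "\<And>M i j. M \<in> C \<Longrightarrow> 0 \<le> M $ i $ j"
    and M_perm: "is_arg_max permanent (\<lambda>M. M \<in> C) M_perm"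
    and M_cap: "is_arg_max (\<lambda>M. capacity (row_product_poly M)) (\<lambda>M. M \<in> C) M_cap"
  shows "fact CARD('n) / real CARD('n) ^ CARD('n) * permanent M_perm \<le> permanent M_cap
    \<and> permanent M_cap \<le> permanent M_perm
    \<and> (\<forall>k::nat. k \<ge> 1 \<longrightarrow> (\<forall>M\<in>C. \<forall>j. card {i. M $ i $ j \<noteq> 0} \<le> k) \<longrightarrow>
        ((real k - 1) / real k) ^ ((k - 1) * CARD('n)) * permanent M_perm \<le> permanent M_cap)"
proof (intro conjI allI impI)
  have C: "M_perm \<in> C" "M_cap \<in> C"
    and le: "permanent M_cap \<le> permanent M_perm"
      "capacity (row_product_poly M_perm) \<le> capacity (row_product_poly M_cap)"
    using M_perm M_cap by (auto simp: is_arg_max_linorder)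
  have "permanent M_perm \<le> capacity (row_product_poly M_perm)"
    by (rule permanent_le_capacity) (rule nonneg[OF C(1)])
  with le have perm_le: "permanent M_perm \<le> capacity (row_product_poly M_cap)" by simp
  \<comment> \<open>Both lower bounds are instances: \<open>d m = m\<close> gives the factorial
    factor, constant \<open>d m = k\<close> gives a \<open>CARD('n)\<close>-th power.\<close>
  have lower: "F * permanent M_perm \<le> permanent M_cap"
    if F: "F = (\<Prod>m\<in>{1..CARD('n)}. gurvits_factor (d m))" and d: "\<And>m. m \<ge> 1 \<Longrightarrow> d m \<ge> 1"
      "\<And>m j. m \<ge> 1 \<Longrightarrow> card {i. M_cap $ i $ j \<noteq> 0} \<le> d m \<or> m \<le> d m" for F d
  proof -
    have "F * permanent M_perm \<le> F * capacity (row_product_poly M_cap)"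
      unfolding F by (intro mult_left_mono perm_le prod_nonneg gurvits_factor_nonneg ballI)
    also have "\<dots> \<le> permanent M_cap"
      unfolding F using nonneg[OF C(2)] d by (rule gurvits_capacity_le_permanent)
    finally show ?thesis .
  qed
  show "fact CARD('n) / real CARD('n) ^ CARD('n) * permanent M_perm \<le> permanent M_cap"
    by (rule lower[of _ "\<lambda>m. m"]) (use prod_gurvits_factor[of "CARD('n)"] in simp_all)
  show "permanent M_cap \<le> permanent M_perm"
    by (rule le)
  fix k :: nat assume k: "k \<ge> 1" "\<forall>M\<in>C. \<forall>j. card {i. M $ i $ j \<noteq> 0} \<le> k"
  show "((real k - 1) / real k) ^ ((k - 1) * CARD('n)) * permanent M_perm \<le> permanent M_cap"
    by (rule lower[of _ "\<lambda>_. k"]) (use k C in \<open>auto simp: gurvits_factor_def power_mult\<close>)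
qed

end
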